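(* Let $X\subset\mathbb{R}^d$ be bounded, $X^c:=\mathbb{R}^d\setminus\overline{X}$, $\eta>0$, and let $f$ be such that for every $x\in X$ the function $f(x,\cdot)$ is harmonic in $X^c$ and vanishes at infinity. Let $\Sigma\subset X^c$ be an unbounded domain with $\Sigma\supset\mathcal{F}_\eta(X)$ and $\partial\Sigma\subset\mathcal{F}_{2\eta}(X)$, and let $M\subset\partial\Sigma$ be a finite set with $\operatorname{dist}(y,M)\le\delta$ for all $y\in\partial\Sigma$. Let $s_k$ be the interpolant and $r_k=f-s_k$ the remainder obtained after $k$ steps of the cross approximation of $f$ with pivots in $X\times M$. Assume $2q\eta\,\delta<\operatorname{diam}X$, where $q=(\sqrt[d]{2}-1)^{-1}+2$. Then for every $x\in X$ $$\max_{y\in\mathcal{F}_\eta(X)}|f(x,y)-s_k(x,y)|\le 2\max_{y\in M}|f(x,y)-s_k(x,y)|+c_k\,q\,\delta,$$ where $c_k:=\|\nabla_y r_k(x,\cdot)\|_\infty$.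
   Context: Far-field: for $\eta>0$, $\mathcal{F}_\eta(X):=\{y\in\mathbb{R}^d:\eta\,\operatorname{dist}(y,X)\ge\operatorname{diam}X\}$. Cross approximation: set $r_0:=f$. For $j=0,1,\dots,k-1$, given $r_j$, choose $x_{j+1}\in X$ such that $r_j(x_{j+1},\cdot)$ is not identically zero on $M$, let $y_{j+1}\in M$ be a maximizer of $|r_j(x_{j+1},\cdot)|$ in $M$, and set $$r_{j+1}(x,y):=r_j(x,y)-\frac{r_j(x_{j+1},y)}{r_j(x_{j+1},y_{j+1})}\,r_j(x,y_{j+1}),\qquad s_{j+1}:=f-r_{j+1}.$$ $\|\cdot\|_\infty$ denotes the supremum norm, here of $|\nabla_y r_k(x,\cdot)|$ over $X^c$, with value $+\infty$ allowed (in which case the bound is void). *)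

theory Defs
  imports "HOL-Analysis.Analysis"
begin

definition gradient :: "(real ^ 'n \<Rightarrow> real) \<Rightarrow> real ^ 'n \<Rightarrow> real ^ 'n" where
  "gradient g y = (\<chi> i. frechet_derivative g (at y) (axis i 1))"

text \<open>The Laplacian is the divergence of the gradient, that is, the trace of the Hessian.\<close>

definition laplacian :: "(real ^ 'n \<Rightarrow> real) \<Rightarrow> real ^ 'n \<Rightarrow> real" where
  "laplacian g y = (\<Sum>i\<in>UNIV. frechet_derivative (gradient g) (at y) (axis i 1) $ i)"

text \<open>Intended for open \<open>U\<close>. The first three conjuncts say that \<open>g\<close> is twice
  continuously differentiable on \<open>U\<close>.\<close>

definition harmonic_on :: "(real ^ 'n \<Rightarrow> real) \<Rightarrow> (real ^ 'n) set \<Rightarrow> bool" where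
  "harmonic_on g U \<longleftrightarrow>
     (\<forall>y\<in>U. g differentiable (at y)) \<and>
     (\<forall>y\<in>U. gradient g differentiable (at y)) \<and>
     (\<forall>h. continuous_on U (\<lambda>y. frechet_derivative (gradient g) (at y) h)) \<and>
     (\<forall>y\<in>U. laplacian g y = 0)"

definition far_field :: "real \<Rightarrow> (real ^ 'n) set \<Rightarrow> (real ^ 'n) set" where
  "far_field \<eta> X = {y. \<eta> * infdist y X \<ge> diameter X}"

text \<open>The pivots \<open>(px j, py j)\<close> are indexed from 1; the values at index 0 are not used.\<close>

primrec cross_remainder ::
  "('a \<Rightarrow> 'b \<Rightarrow> real) \<Rightarrow> (nat \<Rightarrow> 'a) \<Rightarrow> (nat \<Rightarrow> 'b) \<Rightarrow> nat \<Rightarrow> 'a \<Rightarrow> 'b \<Rightarrow> real" where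
  "cross_remainder f px py 0 = f"
| "cross_remainder f px py (Suc j) = (\<lambda>x y.
     cross_remainder f px py j x y
     - cross_remainder f px py j (px (Suc j)) y
       / cross_remainder f px py j (px (Suc j)) (py (Suc j))
       * cross_remainder f px py j x (py (Suc j)))"

definition cross_interpolant ::
  "('a \<Rightarrow> 'b \<Rightarrow> real) \<Rightarrow> (nat \<Rightarrow> 'a) \<Rightarrow> (nat \<Rightarrow> 'b) \<Rightarrow> nat \<Rightarrow> 'a \<Rightarrow> 'b \<Rightarrow> real" where
  "cross_interpolant f px py k x y = f x y - cross_remainder f px py k x y"

definition admissible_pivots ::
  "('a \<Rightarrow> 'b \<Rightarrow> real) \<Rightarrow> 'a set \<Rightarrow> 'b set \<Rightarrow> nat \<Rightarrow> (nat \<Rightarrow> 'a) \<Rightarrow> (nat \<Rightarrow> 'b) \<Rightarrow> bool" where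
  "admissible_pivots f X M k px py \<longleftrightarrow>
     (\<forall>j<k. px (Suc j) \<in> X \<and> py (Suc j) \<in> M \<and>
        (\<exists>y\<in>M. cross_remainder f px py j (px (Suc j)) y \<noteq> 0) \<and>
        (\<forall>y\<in>M. \<bar>cross_remainder f px py j (px (Suc j)) y\<bar>
              \<le> \<bar>cross_remainder f px py j (px (Suc j)) (py (Suc j))\<bar>))"

definition sup_norm_gradient :: "(real ^ 'n \<Rightarrow> real) \<Rightarrow> (real ^ 'n) set \<Rightarrow> ereal" where
  "sup_norm_gradient g U = (SUP y\<in>U. ereal (norm (gradient g y)))"

end

theory Submission
  imports Defs
begin

text \<open>The remainder \<open>r\<^sub>k(x,\<cdot>)\<close> is a linear combination of functions that are harmonic in
  \<open>X\<^sup>c\<close> and vanish at infinity, so by the maximum principle it is bounded on \<open>\<Sigma>\<close> by its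
  values on \<open>\<partial>\<Sigma>\<close>. A point of \<open>\<partial>\<Sigma>\<close> is joined to a point of \<open>M\<close> by a segment of length
  at most \<open>\<delta>\<close>, which stays in \<open>X\<^sup>c\<close> because \<open>\<delta> < dist(\<partial>\<Sigma>, X)\<close>; the mean value
  inequality along it gives the bound even with constants 1 in place of 2 and \<open>q\<close>.\<close>

section \<open>Gradients and linear combinations of harmonic functions\<close>

lemma frechet_derivative_eq_inner_gradient:
  fixes g :: "real ^ 'n \<Rightarrow> real"
  assumes "g differentiable (at y)"
  shows "frechet_derivative g (at y) h = gradient g y \<bullet> h"
proof -
  have lin: "linear (frechet_derivative g (at y))"
    by (rule linear_frechet_derivative[OF assms])
  have "frechet_derivative g (at y) h = frechet_derivative g (at y) (\<Sum>i\<in>UNIV. h $ i *\<^sub>R axis i 1)"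
    using basis_expansion[of h] by (simp add: scalar_mult_eq_scaleR)
  also have "\<dots> = (\<Sum>i\<in>UNIV. h $ i * frechet_derivative g (at y) (axis i 1))"
    by (simp add: linear_sum[OF lin] linear_scale[OF lin])
  also have "\<dots> = gradient g y \<bullet> h"
    by (simp add: inner_vec_def gradient_def mult.commute)
  finally show ?thesis .
qed

lemma gradient_diff_cmult:
  assumes "g differentiable (at y)" "h differentiable (at y)"
  shows "gradient (\<lambda>z. g z - c * h z) y = gradient g y - c *\<^sub>R gradient h y"
proof -
  have "((\<lambda>z. g z - c * h z) has_derivative
      (\<lambda>v. frechet_derivative g (at y) v - c * frechet_derivative h (at y) v)) (at y)"
    using assms by (auto intro!: derivative_intros simp: frechet_derivative_works[symmetric])
  from frechet_derivative_at[OF this] show ?thesis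
    by (simp add: gradient_def vec_eq_iff fun_eq_iff)
qed

text \<open>This combination is one step of the cross approximation as a function of y. With
  \<open>h = g\<close> and \<open>c = 2\<close> it also yields negation.\<close>

lemma harmonic_on_diff_cmult:
  assumes "open U" "harmonic_on g U" "harmonic_on h U"
  shows "harmonic_on (\<lambda>z. g z - c * h z) U"
proof -
  let ?f = "\<lambda>z. g z - c * h z"
  let ?G = "\<lambda>y v. frechet_derivative (gradient g) (at y) v - c *\<^sub>R frechet_derivative (gradient h) (at y) v"
  have d: "g differentiable (at y)" "h differentiable (at y)"
    "gradient g differentiable (at y)" "gradient h differentiable (at y)" if "y \<in> U" for y
    using assms that by (auto simp: harmonic_on_def)
  \<comment> \<open>The formula for the gradient holds on all of the open set \<open>U\<close>,
    hence near \<open>y\<close>, and may therefore be differentiated once more at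
    \<open>y\<close>.\<close>
  have G: "(gradient ?f has_derivative ?G y) (at y)" if y: "y \<in> U" for y
  proof (rule has_derivative_transform_within_open[OF _ \<open>open U\<close> y])
    show "((\<lambda>z. gradient g z - c *\<^sub>R gradient h z) has_derivative ?G y) (at y)"
      using d[OF y] by (auto intro!: derivative_intros simp: frechet_derivative_works[symmetric])
  qed (simp add: gradient_diff_cmult d)
  have fd: "frechet_derivative (gradient ?f) (at y) = ?G y" if "y \<in> U" for y
    using frechet_derivative_at[OF G[OF that]] by simp
  have "continuous_on U (\<lambda>y. ?G y v)" for v
    using assms by (intro continuous_intros) (auto simp: harmonic_on_def)
  hence "continuous_on U (\<lambda>y. frechet_derivative (gradient ?f) (at y) v)" for v
    by (subst continuous_on_cong[OF refl fd[THEN fun_cong]]) auto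
  moreover have "laplacian ?f y = 0" if "y \<in> U" for y
  proof -
    have "laplacian ?f y = laplacian g y - c * laplacian h y"
      by (simp add: laplacian_def fd[OF that] sum_subtractf sum_distrib_left)
    thus ?thesis using assms that by (simp add: harmonic_on_def)
  qed
  ultimately show ?thesis
    using G d unfolding harmonic_on_def
    by (auto simp: differentiable_def[of "gradient ?f"] intro!: differentiable_diff differentiable_mult)
qed

lemma harmonic_on_subset: "harmonic_on g U \<Longrightarrow> V \<subseteq> U \<Longrightarrow> harmonic_on g V"
  unfolding harmonic_on_def by (meson continuous_on_subset subset_iff)

lemma harmonic_on_imp_continuous_on: "harmonic_on g U \<Longrightarrow> continuous_on U g"
  by (auto simp: harmonic_on_def intro!: continuous_at_imp_continuous_on differentiable_imp_continuous_within)

text \<open>Each step subtracts from the row at \<open>x\<close> a multiple of the row at the pivot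
  \<open>px (Suc k)\<close>. Both rows come from the previous remainder, so the induction has to run
  over all points of \<open>X\<close> at once.\<close>

lemma cross_remainder_harmonic_vanishing:
  assumes "open U"
    and "\<And>x. x \<in> X \<Longrightarrow> harmonic_on (f x) U"
    and "\<And>x. x \<in> X \<Longrightarrow> (f x \<longlongrightarrow> 0) at_infinity"
    and "\<And>j. j < k \<Longrightarrow> px (Suc j) \<in> X" and "x \<in> X"
  shows "harmonic_on (cross_remainder f px py k x) U
    \<and> (cross_remainder f px py k x \<longlongrightarrow> 0) at_infinity"
  using assms(4,5)
proof (induction k arbitrary: x)
  case 0
  then show ?case using assms(2,3) by simp
next
  case (Suc k)
  let ?r = "cross_remainder f px py k" and ?p = "px (Suc k)" and ?y = "py (Suc k)"
  \<comment> \<open>The quotient is regrouped so that the factor of the pivot row is constant in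
    \<open>y\<close>.\<close>
  have eq: "cross_remainder f px py (Suc k) x = (\<lambda>y. ?r x y - (?r x ?y / ?r ?p ?y) * ?r ?p y)"
    by (simp add: fun_eq_iff)
  have IH: "harmonic_on (?r z) U" "(?r z \<longlongrightarrow> 0) at_infinity" if "z \<in> X" for z
    using Suc.IH[of z] Suc.prems(1) that by auto
  have p: "?p \<in> X" using Suc.prems(1) by simp
  have "((\<lambda>y. ?r x y - (?r x ?y / ?r ?p ?y) * ?r ?p y) \<longlongrightarrow> 0 - (?r x ?y / ?r ?p ?y) * 0) at_infinity"
    by (intro tendsto_intros IH p Suc.prems(2))
  then show ?case
    unfolding eq
    using harmonic_on_diff_cmult[OF \<open>open U\<close> IH(1)[OF Suc.prems(2)] IH(1)[OF p]]
    by (simp only: mult_zero_right diff_zero simp_thms)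
qed

section \<open>The maximum principle and functions vanishing at infinity\<close>

text \<open>Adding \<open>\<epsilon>|y|\<^sup>2\<close> makes the Laplacian strictly positive, so that some pure second
  derivative is positive at every point.\<close>

lemma harmonic_perturbed_no_max:
  fixes u :: "real ^ 'n \<Rightarrow> real"
  assumes "open W" "p \<in> W" "harmonic_on u W" "\<epsilon> > 0"
    and max: "\<And>y. y \<in> W \<Longrightarrow> u y + \<epsilon> * (norm y)\<^sup>2 \<le> u p + \<epsilon> * (norm p)\<^sup>2"
  shows False
proof -
  let ?H = "frechet_derivative (gradient u) (at p)"
  have "(\<Sum>i\<in>UNIV. ?H (axis i 1) $ i) = 0"
    using assms by (simp add: harmonic_on_def laplacian_def)
  hence "(\<Sum>i\<in>(UNIV::'n set). ?H (axis i 1) $ i + 2 * \<epsilon>) > 0"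
    using \<open>\<epsilon> > 0\<close> by (simp add: sum.distrib)
  then obtain i where i: "?H (axis i 1) $ i + 2 * \<epsilon> > 0"
    by (meson not_le sum_nonpos)
  define e :: "real ^ 'n" where "e = axis i 1"
  \<comment> \<open>\<open>\<phi>\<close> is the perturbed function on the line through
    \<open>p\<close> in direction \<open>e\<close>, less the constant
    \<open>\<epsilon> * (norm p)\<^sup>2\<close>; \<open>g\<close> is its derivative.\<close>
  define \<phi> where "\<phi> t = u (p + t *\<^sub>R e) + \<epsilon> * (2 * t * p $ i + t\<^sup>2)" for t
  define g where "g t = gradient u (p + t *\<^sub>R e) $ i + \<epsilon> * (2 * p $ i + 2 * t)" for t
  obtain r where r: "r > 0" "ball p r \<subseteq> W"
    using assms openE by blast
  have inW: "p + t *\<^sub>R e \<in> W" if "\<bar>t\<bar> < r" for t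
    using r(2) that by (auto simp: dist_norm e_def norm_axis_1 subset_iff)
  have nrm: "(norm (p + t *\<^sub>R e))\<^sup>2 = (norm p)\<^sup>2 + (2 * t * p $ i + t\<^sup>2)" for t
    by (simp only: power2_norm_eq_inner)
       (simp add: inner_add_left inner_add_right e_def inner_axis inner_axis' power2_eq_square algebra_simps)
  have \<phi>_max: "\<phi> t \<le> \<phi> 0" if "\<bar>t\<bar> < r" for t
    using max[OF inW[OF that]] by (simp add: \<phi>_def nrm algebra_simps)
  have line: "((\<lambda>t. p + t *\<^sub>R e) has_derivative (\<lambda>t. t *\<^sub>R e)) (at t)" for t
    by (auto intro!: derivative_eq_intros)
  have D\<phi>: "(\<phi> has_real_derivative g t) (at t)" if t: "\<bar>t\<bar> < r" for t
  proof -
    have d: "u differentiable (at (p + t *\<^sub>R e))"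
      using inW[OF t] assms(3) by (simp add: harmonic_on_def)
    have "((\<lambda>t. u (p + t *\<^sub>R e)) has_derivative
        (\<lambda>s. frechet_derivative u (at (p + t *\<^sub>R e)) (s *\<^sub>R e))) (at t)"
      using diff_chain_at[OF line d[unfolded frechet_derivative_works]] by (simp add: o_def)
    hence "((\<lambda>t. u (p + t *\<^sub>R e)) has_real_derivative gradient u (p + t *\<^sub>R e) $ i) (at t)"
      unfolding has_field_derivative_def frechet_derivative_eq_inner_gradient[OF d]
      by (simp add: e_def inner_axis mult_commute_abs)
    moreover have "((\<lambda>t. \<epsilon> * (2 * t * p $ i + t\<^sup>2)) has_real_derivative \<epsilon> * (2 * p $ i + 2 * t)) (at t)"
      by (auto intro!: derivative_eq_intros)
    ultimately show ?thesis unfolding \<phi>_def g_def by (rule DERIV_add)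
  qed
  have Dg: "(g has_real_derivative (?H (axis i 1) $ i + 2 * \<epsilon>)) (at 0)"
  proof -
    have d: "gradient u differentiable (at (p + 0 *\<^sub>R e))"
      using assms by (simp add: harmonic_on_def)
    have "((\<lambda>t. gradient u (p + t *\<^sub>R e)) has_derivative (\<lambda>s. ?H (s *\<^sub>R e))) (at 0)"
      using diff_chain_at[OF line d[unfolded frechet_derivative_works]] by (simp add: o_def)
    hence "((\<lambda>t. gradient u (p + t *\<^sub>R e) $ i) has_derivative (\<lambda>s. ?H (s *\<^sub>R e) $ i)) (at 0)"
      by (rule bounded_linear.has_derivative[OF bounded_linear_vec_nth])
    moreover have "?H (s *\<^sub>R e) $ i = s * ?H e $ i" for s
      using linear_scale[OF linear_frechet_derivative[OF d], of s e] by simp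
    ultimately have "((\<lambda>t. gradient u (p + t *\<^sub>R e) $ i) has_real_derivative ?H e $ i) (at 0)"
      by (simp add: has_field_derivative_def mult_commute_abs)
    moreover have "((\<lambda>t. \<epsilon> * (2 * p $ i + 2 * t)) has_real_derivative 2 * \<epsilon>) (at 0)"
      by (auto intro!: derivative_eq_intros)
    ultimately show ?thesis unfolding g_def e_def by (rule DERIV_add)
  qed
  \<comment> \<open>The first derivative vanishes at the maximum while the second is positive. Hence
    \<open>g\<close> is positive just to the right of 0, and the mean value theorem makes
    \<open>\<phi>\<close> exceed its maximum there.\<close>
  have g0: "g 0 = 0"
    using DERIV_local_max[OF D\<phi> r(1), of 0] r(1) \<phi>_max by auto
  obtain d where d: "d > 0" "\<And>h. 0 < h \<Longrightarrow> h < d \<Longrightarrow> g 0 < g (0 + h)"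
    using DERIV_pos_inc_right[OF Dg i] by blast
  define h where "h = min d r / 2"
  have h: "0 < h" "h < d" "h < r" using d r by (auto simp: h_def min_def)
  obtain z where z: "0 < z" "z < h" "\<phi> h - \<phi> 0 = (h - 0) * g z"
    using MVT2[OF h(1), of \<phi> g] D\<phi> h by (metis abs_of_nonneg order_le_less_trans)
  have "g z > 0" using d(2)[of z] z h g0 by auto
  hence "\<phi> h > \<phi> 0" using z h by (smt (verit) mult_pos_pos)
  thus False using \<phi>_max[of h] h by auto
qed

text \<open>If \<open>u a\<close> exceeded \<open>B\<close>, the perturbed function would have a
  maximum over the part of the closure in a large ball. It cannot lie on the frontier, where
  \<open>u\<close> is at most \<open>B\<close>, nor on the sphere, where \<open>u\<close> is already
  small; an interior maximum is impossible.\<close>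

lemma harmonic_le_frontier_bound:
  fixes u :: "real ^ 'n \<Rightarrow> real"
  assumes "open S" "harmonic_on u S" "continuous_on (closure S) u" "(u \<longlongrightarrow> 0) at_infinity"
    and "B \<ge> 0" and fr: "\<And>y. y \<in> frontier S \<Longrightarrow> u y \<le> B" and "a \<in> S"
  shows "u a \<le> B"
proof (rule ccontr)
  define e where "e = u a - B"
  assume "\<not> u a \<le> B"
  hence e: "e > 0" by (simp add: e_def)
  have "\<forall>\<^sub>F y in at_infinity. \<bar>u y\<bar> < e / 2"
    using tendstoD[OF assms(4), of "e/2"] e by (simp add: dist_real_def)
  then obtain R0 where R0: "\<And>y. norm y \<ge> R0 \<Longrightarrow> \<bar>u y\<bar> < e / 2"
    by (auto simp: eventually_at_infinity)
  \<comment> \<open>Large enough that \<open>u\<close> is below \<open>e / 2\<close> on the sphere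
    and that \<open>a\<close> lies in the ball.\<close>
  define R where "R = \<bar>R0\<bar> + norm a + 1"
  have R: "R > 0" "R \<ge> R0" "R > norm a" using norm_ge_zero[of a] unfolding R_def by linarith+
  \<comment> \<open>On the ball the perturbation is then at most \<open>e / 4\<close>, so the
    maximizer \<open>p\<close> keeps more than half of the excess \<open>e\<close> over
    \<open>B\<close>.\<close>
  define \<epsilon> where "\<epsilon> = e / (4 * R\<^sup>2)"
  have \<epsilon>: "\<epsilon> > 0" using e R by (simp add: \<epsilon>_def)
  let ?v = "\<lambda>y. u y + \<epsilon> * (norm y)\<^sup>2"
  have K: "compact (closure S \<inter> cball 0 R)"
    by (simp add: closed_Int_compact)
  have aK: "a \<in> closure S \<inter> cball 0 R"
    using R \<open>a \<in> S\<close> closure_subset[of S] by auto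
  have "continuous_on (closure S \<inter> cball 0 R) ?v"
    by (intro continuous_intros continuous_on_subset[OF assms(3)]) auto
  then obtain p where p: "p \<in> closure S \<inter> cball 0 R"
    and pmax: "\<And>y. y \<in> closure S \<inter> cball 0 R \<Longrightarrow> ?v y \<le> ?v p"
    using continuous_attains_sup[OF K] aK by blast
  have "?v p \<ge> B + e" using pmax[OF aK] \<epsilon> by (smt (verit) e_def mult_nonneg_nonneg zero_le_power2)
  moreover have "\<epsilon> * (norm p)\<^sup>2 \<le> \<epsilon> * R\<^sup>2"
    using p \<epsilon> by (intro mult_left_mono power_mono) auto
  moreover have "\<epsilon> * R\<^sup>2 = e / 4" using R by (simp add: \<epsilon>_def)
  ultimately have up: "u p > B + e / 2" using e by linarith
  have "p \<in> S"
    using fr[of p] up e p \<open>open S\<close> by (auto simp: frontier_def interior_open)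
  moreover have "norm p < R"
    using up R0[of p] p R \<open>B \<ge> 0\<close> by (auto simp: less_le)
  ultimately have "p \<in> S \<inter> ball 0 R" by simp
  thus False
  proof (rule harmonic_perturbed_no_max[rotated, OF _ harmonic_on_subset[OF assms(2)] \<epsilon>])
    fix y assume "y \<in> S \<inter> ball 0 R"
    thus "?v y \<le> ?v p" using closure_subset[of S] by (intro pmax) auto
  qed (use \<open>open S\<close> in auto)
qed

text \<open>A nonzero value at some \<open>b\<close> in \<open>S\<close> dominates all values
  outside a large ball, so the maximum over the compact part inside the ball is global.\<close>

lemma abs_attains_sup_vanishing_at_infinity:
  fixes u :: "'a :: euclidean_space \<Rightarrow> real"
  assumes "closed S" "S \<noteq> {}" "continuous_on S u" "(u \<longlongrightarrow> 0) at_infinity"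
  shows "\<exists>a\<in>S. \<forall>y\<in>S. \<bar>u y\<bar> \<le> \<bar>u a\<bar>"
proof (cases "\<forall>y\<in>S. u y = 0")
  case True
  then show ?thesis using \<open>S \<noteq> {}\<close> by auto
next
  case False
  then obtain b where b: "b \<in> S" "u b \<noteq> 0" by auto
  have "\<forall>\<^sub>F y in at_infinity. \<bar>u y\<bar> < \<bar>u b\<bar>"
    using tendstoD[OF assms(4), of "\<bar>u b\<bar>"] b by (simp add: dist_real_def)
  then obtain R where R: "\<And>y. norm y \<ge> R \<Longrightarrow> \<bar>u y\<bar> < \<bar>u b\<bar>"
    by (auto simp: eventually_at_infinity)
  \<comment> \<open>Outside the ball, \<open>b\<close> would satisfy
    \<open>\<bar>u b\<bar> < \<bar>u b\<bar>\<close>.\<close>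
  have bK: "b \<in> S \<inter> cball 0 R" using b R[of b] by force
  have "compact (S \<inter> cball 0 R)" using assms by (simp add: closed_Int_compact)
  moreover have "continuous_on (S \<inter> cball 0 R) (\<lambda>y. \<bar>u y\<bar>)"
    by (intro continuous_intros continuous_on_subset[OF assms(3)]) auto
  ultimately obtain a where a: "a \<in> S \<inter> cball 0 R" "\<And>y. y \<in> S \<inter> cball 0 R \<Longrightarrow> \<bar>u y\<bar> \<le> \<bar>u a\<bar>"
    using continuous_attains_sup[of "S \<inter> cball 0 R" "\<lambda>y. \<bar>u y\<bar>"] bK by blast
  have "\<bar>u y\<bar> \<le> \<bar>u a\<bar>" if "y \<in> S" for y
  proof (cases "norm y \<ge> R")
    case True
    then show ?thesis using R[of y] a(2)[OF bK] by linarith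
  qed (use a that in auto)
  then show ?thesis using a by auto
qed

section \<open>The far field and the mean value inequality\<close>

lemma closed_far_field: "closed (far_field \<eta> X)"
  unfolding far_field_def by (intro closed_Collect_le continuous_intros)

lemma far_field_nonempty:
  fixes X :: "(real ^ 'n) set"
  assumes "bounded X" "\<eta> > 0" "X \<noteq> {}"
  shows "far_field \<eta> X \<noteq> {}"
proof -
  obtain b where b: "b > 0" "\<And>x. x \<in> X \<Longrightarrow> norm x \<le> b"
    using \<open>bounded X\<close> by (auto simp: bounded_pos)
  have D: "diameter X \<ge> 0" using assms by (simp add: diameter_ge_0)
  \<comment> \<open>By the reverse triangle inequality, a point of this norm is at distance at least
    \<open>diameter X / \<eta>\<close> from the ball of radius \<open>b\<close> that contains
    \<open>X\<close>.\<close>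
  obtain y :: "real ^ 'n" where y: "norm y = b + diameter X / \<eta>"
    using vector_choose_size[of "b + diameter X / \<eta>"] b D \<open>\<eta> > 0\<close> by auto
  have "diameter X / \<eta> \<le> dist y x" if "x \<in> X" for x
    using b(2)[OF that] y norm_triangle_ineq2[of y x] by (simp add: dist_norm)
  hence "diameter X / \<eta> \<le> infdist y X"
    using \<open>X \<noteq> {}\<close> by (auto simp: infdist_notempty intro!: cINF_greatest)
  hence "y \<in> far_field \<eta> X" using \<open>\<eta> > 0\<close> by (simp add: far_field_def field_simps)
  thus ?thesis by auto
qed

text \<open>By Cauchy-Schwarz the gradient bounds the operator norm of the derivative at each point
  of the segment.\<close>

lemma abs_diff_le_sup_norm_gradient:
  fixes u :: "real ^ 'n \<Rightarrow> real"
  assumes diff: "\<And>w. w \<in> U \<Longrightarrow> u differentiable (at w)"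
    and seg: "closed_segment y z \<subseteq> U"
    and c: "sup_norm_gradient u U = ereal c"
  shows "\<bar>u y - u z\<bar> \<le> c * dist y z"
proof -
  have "norm (u y - u z) \<le> c * norm (y - z)"
  proof (rule differentiable_bound[OF convex_closed_segment[of y z]])
    fix w assume w: "w \<in> closed_segment y z"
    have d: "u differentiable (at w)" using diff seg w by blast
    thus "(u has_derivative frechet_derivative u (at w)) (at w within closed_segment y z)"
      by (simp add: frechet_derivative_works has_derivative_at_withinI)
    have "ereal (norm (gradient u w)) \<le> ereal c"
      unfolding c[symmetric] sup_norm_gradient_def using seg w by (intro SUP_upper) auto
    hence "norm (frechet_derivative u (at w) h) \<le> c * norm h" for h
      using Cauchy_Schwarz_ineq2[of "gradient u w" h]
      by (simp add: frechet_derivative_eq_inner_gradient[OF d])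
         (meson mult_right_mono norm_ge_zero order_trans)
    thus "onorm (frechet_derivative u (at w)) \<le> c" by (rule onorm_le)
  qed auto
  thus ?thesis by (simp add: dist_norm)
qed

section \<open>The error estimate on the far field\<close>

theorem lemma2:
  fixes X \<Sigma> M :: "(real ^ 'n) set"
    and f :: "real ^ 'n \<Rightarrow> real ^ 'n \<Rightarrow> real"
    and px py :: "nat \<Rightarrow> real ^ 'n"
    and \<eta> \<delta> q :: real
    and k :: nat
  assumes "bounded X"
    and "\<eta> > 0"
    and "\<And>x. x \<in> X \<Longrightarrow> harmonic_on (f x) (- closure X)"
    and "\<And>x. x \<in> X \<Longrightarrow> (f x \<longlongrightarrow> 0) at_infinity"
    and "open \<Sigma>" and "connected \<Sigma>" and "\<not> bounded \<Sigma>"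
    and "\<Sigma> \<subseteq> - closure X"
    and "far_field \<eta> X \<subseteq> \<Sigma>"
    and "frontier \<Sigma> \<subseteq> far_field (2 * \<eta>) X"
    and "finite M" and "M \<noteq> {}" and "M \<subseteq> frontier \<Sigma>"
    and "\<And>y. y \<in> frontier \<Sigma> \<Longrightarrow> infdist y M \<le> \<delta>"
    and "admissible_pivots f X M k px py"
    and "q = inverse (root CARD('n) 2 - 1) + 2"
    and "2 * q * \<eta> * \<delta> < diameter X"
  shows "\<forall>x\<in>X. \<exists>y\<^sub>0\<in>far_field \<eta> X.
           (\<forall>y\<in>far_field \<eta> X. \<bar>f x y - cross_interpolant f px py k x y\<bar>
                              \<le> \<bar>f x y\<^sub>0 - cross_interpolant f px py k x y\<^sub>0\<bar>) \<and>
           ereal \<bar>f x y\<^sub>0 - cross_interpolant f px py k x y\<^sub>0\<bar>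
             \<le> ereal (2 * Max ((\<lambda>y. \<bar>f x y - cross_interpolant f px py k x y\<bar>) ` M))
               + sup_norm_gradient (cross_remainder f px py k x) (- closure X) * ereal (q * \<delta>)"
proof
  fix x assume x: "x \<in> X"
  define u where "u = cross_remainder f px py k x"
  have fu: "f x y - cross_interpolant f px py k x y = u y" for y
    by (simp add: cross_interpolant_def u_def)
  have piv: "px (Suc j) \<in> X" if "j < k" for j
    using \<open>admissible_pivots f X M k px py\<close> that by (simp add: admissible_pivots_def)
  have u: "harmonic_on u (- closure X)" "(u \<longlongrightarrow> 0) at_infinity"
    using cross_remainder_harmonic_vanishing[of "- closure X" X f k px x py] assms(3,4) piv x
    by (auto simp: u_def)
  have cont: "continuous_on (- closure X) u"
    by (rule harmonic_on_imp_continuous_on[OF u(1)])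
  have q: "q \<ge> 1"
    using assms(16) real_root_gt_1_iff[of "CARD('n)" 2] by (simp add: add_nonneg_nonneg)
  have \<delta>: "\<delta> \<ge> 0"
    using assms(12-14) infdist_nonneg by (meson ex_in_conv order_trans subsetD)
  \<comment> \<open>Both sides are compared with \<open>diameter X\<close>: the left is at least
    that on the frontier, the right is smaller by the assumption on \<delta>.\<close>
  have far: "2 * \<eta> * infdist y X > 2 * \<eta> * (q * \<delta>)" if "y \<in> frontier \<Sigma>" for y
    using assms(10,17) that by (auto simp: far_field_def mult_ac)
  have far': "infdist y X > q * \<delta>" if "y \<in> frontier \<Sigma>" for y
    using far[OF that] \<open>\<eta> > 0\<close> by simp
  have \<delta>_le: "\<delta> \<le> q * \<delta>" using q \<delta> mult_right_mono[of 1 q \<delta>] by simp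
  have compl: "y \<in> - closure X" if "infdist y X > 0" for y
    using that x in_closure_iff_infdist_zero[of X y] by auto
  have clos: "closure \<Sigma> \<subseteq> - closure X"
  proof
    fix y assume "y \<in> closure \<Sigma>"
    then consider "y \<in> \<Sigma>" | "y \<in> frontier \<Sigma>"
      using \<open>open \<Sigma>\<close> by (auto simp: frontier_def interior_open)
    thus "y \<in> - closure X"
      using assms(8) compl far'[of y] \<delta> \<delta>_le by cases auto
  qed
  have sub: "far_field \<eta> X \<subseteq> - closure X" using assms(8,9) by blast
  obtain y\<^sub>0 where y0: "y\<^sub>0 \<in> far_field \<eta> X" "\<And>y. y \<in> far_field \<eta> X \<Longrightarrow> \<bar>u y\<bar> \<le> \<bar>u y\<^sub>0\<bar>"
    using abs_attains_sup_vanishing_at_infinity[OF closed_far_field far_field_nonempty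
        continuous_on_subset[OF cont sub] u(2)] assms(1,2) x by blast
  let ?m = "Max ((\<lambda>y. \<bar>u y\<bar>) ` M)" and ?c = "sup_norm_gradient u (- closure X)"
  have m: "\<bar>u z\<bar> \<le> ?m" if "z \<in> M" for z
    using that \<open>finite M\<close> by (intro Max_ge) auto
  hence m0: "?m \<ge> 0" using \<open>M \<noteq> {}\<close> by (meson abs_ge_zero ex_in_conv order_trans)
  \<comment> \<open>The point \<open>y\<^sub>0\<close> shows that the supremum is over a nonempty
    set, which excludes minus infinity.\<close>
  have c0: "?c \<ge> 0"
    unfolding sup_norm_gradient_def using y0 sub by (intro SUP_upper2[of y\<^sub>0]) auto
  have nearest: "\<exists>z\<in>M. dist y z \<le> \<delta>" if "y \<in> frontier \<Sigma>" for y
    using infdist_attains_inf[of M y] assms(11,12,14) that by (metis finite_imp_closed)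
  have fr: "ereal \<bar>u y\<bar> \<le> ereal (2 * ?m) + ?c * ereal (q * \<delta>)" if y: "y \<in> frontier \<Sigma>" for y
  proof -
    obtain z where z: "z \<in> M" "dist y z \<le> \<delta>" using nearest[OF y] by blast
    \<comment> \<open>In \<open>ereal\<close>, infinity times 0 is 0, so an infinite
      \<open>?c\<close> makes the bound void only for positive \<delta>. For \<delta> = 0 the point
      \<open>y\<close> coincides with \<open>z\<close> in \<open>M\<close>.\<close>
    consider "\<delta> = 0" | "?c = \<infinity>" "\<delta> > 0" | c where "?c = ereal c"
      using \<delta>[unfolded le_less] c0 by (cases ?c) auto
    thus ?thesis
    proof cases
      case 1
      then show ?thesis using z m[of z] m0 by (auto simp: zero_ereal_def[symmetric])
    next
      case 2
      then show ?thesis using q by simp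
    next
      case 3
      \<comment> \<open>Each point of the segment is within \<delta> of \<open>y\<close>, while
        \<open>y\<close> is farther than \<delta> from \<open>X\<close>.\<close>
      have "closed_segment y z \<subseteq> - closure X"
      proof
        fix w assume "w \<in> closed_segment y z"
        hence "dist y w \<le> \<delta>" using z(2) dist_in_closed_segment[of w y z] by (simp add: dist_commute)
        thus "w \<in> - closure X"
          using far'[OF y] \<delta>_le infdist_triangle[of y X w] by (intro compl) linarith
      qed
      hence "\<bar>u y - u z\<bar> \<le> c * dist y z"
        using u(1) 3 by (intro abs_diff_le_sup_norm_gradient) (auto simp: harmonic_on_def)
      also have "\<dots> \<le> c * (q * \<delta>)"
        using c0 3 z(2) \<delta>_le by (intro mult_left_mono) auto
      finally have "\<bar>u y\<bar> \<le> 2 * ?m + c * (q * \<delta>)" using m[OF z(1)] m0 by linarith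
      thus ?thesis by (simp add: 3)
    qed
  qed
  have "ereal \<bar>u y\<^sub>0\<bar> \<le> ereal (2 * ?m) + ?c * ereal (q * \<delta>)" (is "_ \<le> ?B")
  \<comment> \<open>The maximum principle needs a real bound and is applied to \<open>u\<close> and
    to \<open>- u\<close>. An infinite bound is trivial, and minus infinity contradicts
    \<open>fr\<close> at a point of \<open>M\<close>.\<close>
  proof (cases ?B)
    case (real b)
    have S: "y\<^sub>0 \<in> \<Sigma>" using y0 assms(9) by blast
    have fb: "\<bar>u y\<bar> \<le> b" if "y \<in> frontier \<Sigma>" for y using fr[OF that] real by simp
    have b0: "b \<ge> 0" using fb assms(12,13) by (meson abs_ge_zero ex_in_conv order_trans subsetD)
    have hu: "harmonic_on u \<Sigma>" by (rule harmonic_on_subset[OF u(1) assms(8)])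
    have cu: "continuous_on (closure \<Sigma>) u" by (rule continuous_on_subset[OF cont clos])
    have hm: "harmonic_on (\<lambda>z. - u z) \<Sigma>"
      using harmonic_on_diff_cmult[OF \<open>open \<Sigma>\<close> hu hu, of 2] by simp
    have tm: "((\<lambda>z. - u z) \<longlongrightarrow> 0) at_infinity" using tendsto_minus[OF u(2)] by simp
    have "u y\<^sub>0 \<le> b"
      by (rule harmonic_le_frontier_bound[OF \<open>open \<Sigma>\<close> hu cu u(2) b0 _ S]) (use fb in force)
    moreover have "- u y\<^sub>0 \<le> b"
      by (rule harmonic_le_frontier_bound[OF \<open>open \<Sigma>\<close> hm continuous_on_minus[OF cu] tm b0 _ S])
         (use fb in force)
    ultimately show ?thesis using real by simp
  next
    case PInf
    then show ?thesis by (metis ereal_less_eq(1))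
  next
    case MInf
    moreover obtain z where "z \<in> frontier \<Sigma>" using assms(12,13) by blast
    ultimately show ?thesis using fr[of z] by (metis MInfty_neq_ereal(1) ereal_infty_less_eq(2))
  qed
  thus "\<exists>y\<^sub>0\<in>far_field \<eta> X.
           (\<forall>y\<in>far_field \<eta> X. \<bar>f x y - cross_interpolant f px py k x y\<bar>
                              \<le> \<bar>f x y\<^sub>0 - cross_interpolant f px py k x y\<^sub>0\<bar>) \<and>
           ereal \<bar>f x y\<^sub>0 - cross_interpolant f px py k x y\<^sub>0\<bar>
             \<le> ereal (2 * Max ((\<lambda>y. \<bar>f x y - cross_interpolant f px py k x y\<bar>) ` M))
               + sup_norm_gradient (cross_remainder f px py k x) (- closure X) * ereal (q * \<delta>)"
    using y0 unfolding fu by (auto simp: u_def)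
qed

end
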